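(* Let $F\subseteq E(K_n)$ be a set of $p\ge 1$ edges of the complete graph $K_n$ such that $K_n-F$ is connected. Let $Q$ be the edge-defect matrix of $F$ and let $\theta_1,\ldots,\theta_p$ be the eigenvalues of $Q$ with multiplicity, including zero eigenvalues. Then $$\tau(K_n-F)=n^{n-2}\prod_{\alpha=1}^{p}\left(1-\frac{\theta_\alpha}{n}\right)=n^{n-p-2}\det(nI_p-Q).$$
   Context: $K_n-F$ is the graph on the vertices of $K_n$ obtained by deleting the edges in $F=\{e_1,\ldots,e_p\}$. For each deleted edge $e_\alpha=\{u_\alpha,v_\alpha\}$ choose an arbitrary orientation and put $b_\alpha=e_{u_\alpha}-e_{v_\alpha}\in\mathbb{R}^n$, where $e_x$ is the standard basis vector of vertex $x$; put $B=[\,b_1\ \cdots\ b_p\,]$ (an $n\times p$ matrix). The edge-defect matrix of $F$ is the $p\times p$ matrix $Q=B^TB$. $\tau(G)$ denotes the number of spanning trees of $G$. The exponent $n-p-2$ is an integer that may be negative, and $n^{n-p-2}$ is then a rational number. *)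

theory Defs
  imports "Jordan_Normal_Form.Char_Poly"
begin

text \<open>A simple graph is given by its vertex set and its edge set, an edge being the
  two-element set of its end points.\<close>

type_synonym 'a ugraph = "'a set \<times> 'a set set"

abbreviation verts :: "'a ugraph \<Rightarrow> 'a set" where "verts G \<equiv> fst G"
abbreviation edges :: "'a ugraph \<Rightarrow> 'a set set" where "edges G \<equiv> snd G"

definition complete_graph :: "nat \<Rightarrow> nat ugraph" where
  "complete_graph n = ({..<n}, {{x, y} | x y. x < n \<and> y < n \<and> x \<noteq> y})"

definition delete_edges :: "'a ugraph \<Rightarrow> 'a set set \<Rightarrow> 'a ugraph" where
  "delete_edges G F = (verts G, edges G - F)"

definition connected_graph :: "'a ugraph \<Rightarrow> bool" where
  "connected_graph G \<longleftrightarrow> verts G \<noteq> {} \<and>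
     (\<forall>x \<in> verts G. \<forall>y \<in> verts G. (x, y) \<in> {(a, b). {a, b} \<in> edges G}\<^sup>*)"

definition is_cycle :: "'a ugraph \<Rightarrow> 'a list \<Rightarrow> bool" where
  "is_cycle G cs \<longleftrightarrow> 3 \<le> length cs \<and> distinct cs \<and>
     (\<forall>i < length cs. {cs ! i, cs ! (Suc i mod length cs)} \<in> edges G)"

definition is_tree :: "'a ugraph \<Rightarrow> bool" where
  "is_tree G \<longleftrightarrow> connected_graph G \<and> \<not> (\<exists>cs. is_cycle G cs)"

text \<open>A spanning tree contains all vertices, so it is determined by its set of edges.\<close>

definition spanning_trees :: "'a ugraph \<Rightarrow> 'a set set set" where
  "spanning_trees G = {T. T \<subseteq> edges G \<and> is_tree (verts G, T)}"

definition tau :: "'a ugraph \<Rightarrow> nat" where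
  "tau G = card (spanning_trees G)"

text \<open>The list \<open>es\<close> enumerates \<open>F\<close> without repetition, each edge \<open>{u, v}\<close>
  occurring in exactly one of its orientations \<open>(u, v)\<close>, \<open>(v, u)\<close>.\<close>

definition orients :: "('a \<times> 'a) list \<Rightarrow> 'a set set \<Rightarrow> bool" where
  "orients es F \<longleftrightarrow>
     distinct (map (\<lambda>(u, v). {u, v}) es) \<and> set (map (\<lambda>(u, v). {u, v}) es) = F"

definition incidence_mat :: "nat \<Rightarrow> (nat \<times> nat) list \<Rightarrow> real mat" where
  "incidence_mat n es = mat_of_cols n (map (\<lambda>(u, v). unit_vec n u - unit_vec n v) es)"

definition edge_defect_mat :: "nat \<Rightarrow> (nat \<times> nat) list \<Rightarrow> real mat" where
  "edge_defect_mat n es = transpose_mat (incidence_mat n es) * incidence_mat n es"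

text \<open>The eigenvalues with algebraic multiplicity. Only real eigenvalues are counted, which
  loses nothing for a symmetric matrix such as the edge-defect matrix.\<close>

definition eigenvalues_mset :: "real mat \<Rightarrow> real multiset" where
  "eigenvalues_mset A = proots (char_poly A)"

end

theory Submission
  imports Defs
begin

text \<open>Let \<open>L\<close> be the Laplacian of \<open>K\<^sub>n - F\<close> and \<open>J\<close> the all-ones matrix. Then
  \<open>L + J = n I - B B\<^sup>T\<close>, and \<open>n\<^sup>p det (n I - B B\<^sup>T) = n\<^sup>n det (n I - B\<^sup>T B)\<close>, so the claim
  reduces to \<open>det (L + J) = n\<^sup>2 \<tau>\<close> and to the fact that the characteristic polynomial of the
  symmetric matrix \<open>Q\<close> splits over the reals. A congruence by a matrix of determinant \<open>n\<close> turns \<open>L + J\<close>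
  into the Laplacian with the row and column of the root replaced by those of the identity.
  Expanding the determinant of the latter row by row gives one term \<open>det (I - N\<^sub>f)\<close> for each choice
  \<open>f\<close> of a neighbour of every non-root vertex; the term is \<open>1\<close> if iterating \<open>f\<close> always leads to
  the root, and \<open>0\<close> otherwise. The maps \<open>f\<close> of the first kind are the parent maps of the
  spanning trees.\<close>

section \<open>Characteristic polynomials\<close>

text \<open>Both sides come from the block matrix \<open>M\<close>: right multiplication by
  \<open>U\<close> clears its lower left block, by \<open>V\<close> its upper right one. The block
  \<open>c\<close> in \<open>V\<close>, which contributes \<open>c ^ p\<close>, avoids a division by
  \<open>c\<close>.\<close>

lemma det_smult_one_minus_mult_commute:
  fixes B C :: "'a :: idom mat"
  assumes B: "B \<in> carrier_mat n p" and C: "C \<in> carrier_mat p n"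
  shows "c ^ p * det (c \<cdot>\<^sub>m 1\<^sub>m n - B * C) = c ^ n * det (c \<cdot>\<^sub>m 1\<^sub>m p - C * B)"
proof -
  define M where "M = four_block_mat (c \<cdot>\<^sub>m 1\<^sub>m n) B C (1\<^sub>m p)"
  have M: "M \<in> carrier_mat (n + p) (n + p)"
    unfolding M_def by (rule four_block_carrier_mat) auto
  define U where "U = four_block_mat (1\<^sub>m n) (0\<^sub>m n p) (- C) (1\<^sub>m p)"
  define V where "V = four_block_mat (1\<^sub>m n) (- B) (0\<^sub>m p n) (c \<cdot>\<^sub>m 1\<^sub>m p)"
  have U: "U \<in> carrier_mat (n + p) (n + p)" and V: "V \<in> carrier_mat (n + p) (n + p)"
    unfolding U_def V_def by (auto intro!: four_block_carrier_mat)
  have "det U = 1"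
    unfolding U_def using C by (subst det_four_block_mat_upper_right_zero[of _ n _ p]) auto
  moreover have "det V = c ^ p"
    unfolding V_def using B
    by (subst det_four_block_mat_lower_left_zero[of _ n _ p]) (auto simp: det_smult)
  moreover have "M * U = four_block_mat (c \<cdot>\<^sub>m 1\<^sub>m n - B * C) B (0\<^sub>m p n) (1\<^sub>m p)"
    unfolding M_def U_def
    by (subst mult_four_block_mat[of _ n n _ p _ p _ _ n _ p])
      (use B C in \<open>auto intro!: cong_four_block_mat eq_matI\<close>)
  moreover have "(c \<cdot>\<^sub>m 1\<^sub>m n) * (- B) = - (c \<cdot>\<^sub>m B)" "B * (c \<cdot>\<^sub>m 1\<^sub>m p) = c \<cdot>\<^sub>m B"
      "C * (- B) + c \<cdot>\<^sub>m 1\<^sub>m p = c \<cdot>\<^sub>m 1\<^sub>m p - C * B"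
    using B C mult_smult_distrib[OF B one_carrier_mat, of c]
      mult_smult_assoc_mat[OF one_carrier_mat, of "- B" n p c]
    by auto
  moreover from this have "M * V = four_block_mat (c \<cdot>\<^sub>m 1\<^sub>m n) (0\<^sub>m n p) C (c \<cdot>\<^sub>m 1\<^sub>m p - C * B)"
    unfolding M_def V_def
    by (subst mult_four_block_mat[of _ n n _ p _ p _ _ n _ p])
      (use B C in \<open>auto intro!: cong_four_block_mat eq_matI simp:\<close>)
  moreover have "det (four_block_mat (c \<cdot>\<^sub>m 1\<^sub>m n - B * C) B (0\<^sub>m p n) (1\<^sub>m p)) = det (c \<cdot>\<^sub>m 1\<^sub>m n - B * C)"
    using B C by (subst det_four_block_mat_lower_left_zero[of _ n _ p]) auto
  moreover have "det (four_block_mat (c \<cdot>\<^sub>m 1\<^sub>m n) (0\<^sub>m n p) C (c \<cdot>\<^sub>m 1\<^sub>m p - C * B))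
      = c ^ n * det (c \<cdot>\<^sub>m 1\<^sub>m p - C * B)"
    using B C by (subst det_four_block_mat_upper_right_zero[of _ n _ p]) (auto simp: det_smult)
  ultimately show ?thesis
    using det_mult[OF M U] det_mult[OF M V] by (simp add: mult.commute)
qed

section \<open>Spectrum of real symmetric matrices\<close>

text \<open>The value \<open>S\<close> of the sesquilinear form of \<open>A\<close> at an
  eigenvector \<open>v\<close> equals its own conjugate by symmetry, and it is \<open>z\<close>
  times the squared norm of \<open>v\<close>, a nonzero real number.\<close>

lemma real_symmetric_eigenvalue_real:
  fixes A :: "real mat"
  assumes A: "A \<in> carrier_mat n n" and sym: "transpose_mat A = A"
    and ev: "eigenvalue (map_mat complex_of_real A) z"
  shows "z \<in> \<real>"
proof -
  let ?A = "map_mat complex_of_real A"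
  from ev obtain v where v: "v \<in> carrier_vec n" "v \<noteq> 0\<^sub>v n" "?A *\<^sub>v v = z \<cdot>\<^sub>v v"
    using A unfolding eigenvalue_def eigenvector_def by auto
  have symA: "A $$ (i, j) = A $$ (j, i)" if "i < n" "j < n" for i j
    using that A sym index_transpose_mat(1)[of i A j] by auto
  define S where "S = (\<Sum>i<n. \<Sum>j<n. cnj (v $ i) * of_real (A $$ (i, j)) * v $ j)"
  have "(\<Sum>j<n. of_real (A $$ (i, j)) * v $ j) = z * v $ i" if "i < n" for i
  proof -
    have "(?A *\<^sub>v v) $ i = (\<Sum>j<n. of_real (A $$ (i, j)) * v $ j)"
      using that A v(1) by (auto simp: scalar_prod_def atLeast0LessThan intro!: sum.cong)
    with v that show ?thesis by simp
  qed
  then have "S = (\<Sum>i<n. cnj (v $ i) * (z * v $ i))"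
    unfolding S_def by (simp add: mult.assoc flip: sum_distrib_left)
  also have "\<dots> = z * of_real (\<Sum>i<n. (cmod (v $ i))\<^sup>2)"
    by (simp add: sum_distrib_left complex_norm_square mult_ac del: of_real_power)
  finally have S: "S = z * of_real (\<Sum>i<n. (cmod (v $ i))\<^sup>2)" .
  have "cnj S = (\<Sum>i<n. \<Sum>j<n. cnj (v $ j) * of_real (A $$ (j, i)) * v $ i)"
    unfolding S_def by (auto simp: symA mult_ac intro!: sum.cong)
  also have "\<dots> = S"
    unfolding S_def by (rule sum.swap)
  finally have "S \<in> \<real>" by (simp add: Reals_cnj_iff)
  moreover have "(\<Sum>i<n. (cmod (v $ i))\<^sup>2) \<noteq> 0"
  proof
    assume "(\<Sum>i<n. (cmod (v $ i))\<^sup>2) = 0"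
    then have "v $ i = 0" if "i < n" for i
      using that by (subst (asm) sum_nonneg_eq_0_iff) auto
    with v show False by auto
  qed
  ultimately show ?thesis
    unfolding S by (metis Reals_divide Reals_of_real nonzero_mult_div_cancel_right of_real_eq_0_iff)
qed

text \<open>The complex roots are eigenvalues, hence real, and the complex factorization descends
  along the injective embedding of the polynomial rings.\<close>

lemma real_symmetric_char_poly_splits:
  fixes A :: "real mat"
  assumes A: "A \<in> carrier_mat n n" and sym: "transpose_mat A = A"
  shows "\<exists>as. char_poly A = (\<Prod>a\<leftarrow>as. [:- a, 1:]) \<and> length as = n"
proof -
  let ?A = "map_mat complex_of_real A"
  have A': "?A \<in> carrier_mat n n" using A by simp
  from char_poly_factorized[OF A'] obtain as where
    as: "char_poly ?A = (\<Prod>a\<leftarrow>as. [:- a, 1:])" "length as = n" by blast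
  have real: "a \<in> \<real>" if "a \<in> set as" for a
  proof -
    have "poly (char_poly ?A) a = 0"
      unfolding as poly_prod_list using that by (auto simp: prod_list_zero_iff)
    then show ?thesis
      using real_symmetric_eigenvalue_real[OF A sym] eigenvalue_root_char_poly[OF A'] by blast
  qed
  interpret map_poly_inj_idom_hom complex_of_real ..
  have "map_poly complex_of_real (char_poly A) = (\<Prod>a\<leftarrow>as. [:- a, 1:])"
    unfolding of_real_hom.char_poly_hom[OF A, symmetric] by (rule as(1))
  also have "\<dots> = map_poly complex_of_real (\<Prod>a\<leftarrow>map Re as. [:- a, 1:])"
    using real by (induction as) (auto simp: hom_distribs complex_is_Real_iff complex_eq_iff)
  finally have "char_poly A = (\<Prod>a\<leftarrow>map Re as. [:- a, 1:])"
    by simp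
  with as(2) show ?thesis
    by (intro exI[of _ "map Re as"]) simp
qed

text \<open>\<open>eigenvalues_mset\<close> collects real roots only; as the polynomial splits over
  the reals, none is lost, and the order of the list is immaterial.\<close>

lemma real_symmetric_char_poly_eigenvalues:
  fixes A :: "real mat"
  assumes "A \<in> carrier_mat n n" and "transpose_mat A = A"
    and \<theta>: "mset \<theta> = eigenvalues_mset A"
  shows "char_poly A = (\<Prod>t\<leftarrow>\<theta>. [:- t, 1:])" and "length \<theta> = n"
proof -
  from real_symmetric_char_poly_splits[OF assms(1,2)] obtain as where
    as: "char_poly A = (\<Prod>a\<leftarrow>as. [:- a, 1:])" "length as = n" by blast
  have "proots (\<Prod>a\<leftarrow>as. [:- a, 1:]) = mset as"
  proof (induction as)
    case (Cons a as)
    have "(\<Prod>a\<leftarrow>as. [:- a, 1:]) \<noteq> 0"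
      by (auto simp: prod_list_zero_iff)
    with Cons show ?case by (subst list.map, subst prod_list.Cons, subst proots_mult) auto
  qed simp
  then have eq: "mset \<theta> = mset as"
    using \<theta> as(1) by (simp add: eigenvalues_mset_def)
  then show "length \<theta> = n"
    using as(2) mset_eq_length by metis
  have "(\<Prod>a\<leftarrow>as. [:- a, 1:]) = prod_mset (image_mset (\<lambda>a. [:- a, 1:]) (mset as))"
    by (simp flip: prod_mset_prod_list)
  also have "\<dots> = (\<Prod>t\<leftarrow>\<theta>. [:- t, 1:])"
    unfolding eq[symmetric] by (simp flip: prod_mset_prod_list)
  finally show "char_poly A = (\<Prod>t\<leftarrow>\<theta>. [:- t, 1:])"
    using as(1) by simp
qed

section \<open>Spanning trees and parent maps\<close>

text \<open>Trees are rooted at the vertex \<open>0\<close>, which is its own parent so that iterating the parent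
  map stops there.\<close>

definition parents :: "nat \<Rightarrow> nat set set \<Rightarrow> nat \<Rightarrow> nat set" where
  "parents n E i = (if i = 0 then {0} else {k. k < n \<and> {i, k} \<in> E})"

text \<open>Fixing the values outside \<open>{..<n}\<close> makes maps that agree on the vertices
  equal, so that the cardinality counts trees.\<close>

definition parent_maps :: "nat \<Rightarrow> nat set set \<Rightarrow> (nat \<Rightarrow> nat) set" where
  "parent_maps n E = {f \<in> Pi\<^sub>E {..<n} (parents n E). \<forall>i<n. \<exists>k. (f ^^ k) i = 0}"

text \<open>The range starts at \<open>1\<close> because the loop of the root at itself is not an
  edge.\<close>

definition parent_edges :: "nat \<Rightarrow> (nat \<Rightarrow> nat) \<Rightarrow> nat set set" where
  "parent_edges n f = (\<lambda>i. {i, f i}) ` {1..<n}"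

text \<open>The depth of \<open>i\<close> in the rooted tree; meaningful only if some iterate
  reaches \<open>0\<close>.\<close>

definition height :: "(nat \<Rightarrow> nat) \<Rightarrow> nat \<Rightarrow> nat" where
  "height f i = (LEAST k. (f ^^ k) i = 0)"

lemma height_0 [simp]: "height f 0 = 0"
  unfolding height_def by (rule Least_eq_0) simp

lemma height_Suc:
  assumes "(f ^^ k) i = 0" "i \<noteq> 0"
  shows "height f i = Suc (height f (f i))"
proof -
  have "height f i = (LEAST k. (f ^^ Suc k) i = 0) + 1"
    unfolding height_def using Least_Suc[of "\<lambda>k. (f ^^ k) i = 0" k] assms by simp
  then show ?thesis
    by (simp add: height_def funpow_swap1)
qed

lemma parent_mapsD:
  assumes "f \<in> parent_maps n E"
  shows "0 < n \<Longrightarrow> f 0 = 0"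
    and "i < n \<Longrightarrow> 0 < n \<Longrightarrow> f i < n"
    and "0 < i \<Longrightarrow> i < n \<Longrightarrow> {i, f i} \<in> E"
    and "0 < i \<Longrightarrow> i < n \<Longrightarrow> height f i = Suc (height f (f i))"
proof -
  have f: "f i \<in> parents n E i" if "i < n" for i
    using assms that by (auto simp: parent_maps_def)
  show "0 < n \<Longrightarrow> f 0 = 0" "i < n \<Longrightarrow> 0 < n \<Longrightarrow> f i < n" "0 < i \<Longrightarrow> i < n \<Longrightarrow> {i, f i} \<in> E"
    using f[of 0] f[of i] by (auto simp: parents_def split: if_splits)
  show "0 < i \<Longrightarrow> i < n \<Longrightarrow> height f i = Suc (height f (f i))"
    using assms height_Suc by (auto simp: parent_maps_def)
qed

lemma mem_parent_edges_iff:
  "{a, b} \<in> parent_edges n f \<longleftrightarrow> (a \<in> {1..<n} \<and> b = f a) \<or> (b \<in> {1..<n} \<and> a = f b)"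
  by (auto simp: parent_edges_def doubleton_eq_iff)

lemma connected_parent_edges:
  assumes f: "f \<in> parent_maps n E" and n: "0 < n"
  shows "connected_graph ({..<n}, parent_edges n f)"
proof -
  let ?R = "{(a, b). {a, b} \<in> parent_edges n f}"
  \<comment> \<open>Iterating \<open>f\<close> traces a walk along parent edges that rests at
    \<open>0\<close> once it arrives there.\<close>
  have iter: "(x, (f ^^ k) x) \<in> ?R\<^sup>* \<and> (f ^^ k) x < n" if "x < n" for x k
  proof (induction k)
    case (Suc k)
    let ?y = "(f ^^ k) x"
    show ?case
    proof (cases "?y = 0")
      case True
      then show ?thesis using Suc parent_mapsD(1)[OF f n] n by simp
    next
      case False
      then have "(?y, f ?y) \<in> ?R" using Suc by (auto simp: mem_parent_edges_iff)
      then have "(x, f ?y) \<in> ?R\<^sup>*" using Suc by (meson rtrancl.rtrancl_into_rtrancl)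
      then show ?thesis using Suc parent_mapsD(2)[OF f _ n] by simp
    qed
  qed (use that in simp)
  have root: "(x, 0) \<in> ?R\<^sup>*" if x: "x < n" for x
  proof -
    from f x obtain k where "(f ^^ k) x = 0" by (auto simp: parent_maps_def)
    with iter[OF x, of k] show ?thesis by simp
  qed
  have "sym (?R\<^sup>*)"
    by (intro sym_rtrancl) (auto simp: sym_def insert_commute)
  with root have "(x, y) \<in> ?R\<^sup>*" if "x < n" "y < n" for x y
    using that by (meson rtrancl_trans symD)
  with n show ?thesis by (auto simp: connected_graph_def)
qed

text \<open>Both neighbours on a cycle of a vertex of maximal height would have to be its parent.\<close>

lemma parent_edges_acyclic:
  assumes f: "f \<in> parent_maps n E" and n: "0 < n"
  shows "\<not> is_cycle ({..<n}, parent_edges n f) cs"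
proof
  assume "is_cycle ({..<n}, parent_edges n f) cs"
  then have len: "3 \<le> length cs" and dist: "distinct cs"
    and edge: "\<And>i. i < length cs \<Longrightarrow> {cs ! i, cs ! (Suc i mod length cs)} \<in> parent_edges n f"
    by (auto simp: is_cycle_def)
  let ?N = "length cs"
  have "Max ((\<lambda>i. height f (cs ! i)) ` {..<?N}) \<in> (\<lambda>i. height f (cs ! i)) ` {..<?N}"
    using len by (intro Max_in) (auto simp: lessThan_empty_iff)
  then obtain i where i: "i < ?N" and "Max ((\<lambda>i. height f (cs ! i)) ` {..<?N}) = height f (cs ! i)"
    by auto
  then have max: "height f (cs ! j) \<le> height f (cs ! i)" if "j < ?N" for j
    using that by (metis Max_ge finite_imageI finite_lessThan imageI lessThan_iff)
  \<comment> \<open>A child is higher by one, so a neighbour that is not higher must be the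
    parent.\<close>
  have parent: "x = f (cs ! i)" if "{cs ! i, x} \<in> parent_edges n f" "height f x \<le> height f (cs ! i)" for x
    using that parent_mapsD(4)[OF f, of x] by (auto simp: mem_parent_edges_iff)
  define j where "j = Suc i mod ?N"
  \<comment> \<open>The cyclic predecessor of \<open>i\<close>; adding \<open>?N\<close> first
    avoids truncated subtraction at \<open>i = 0\<close>.\<close>
  define k where "k = (i + ?N - 1) mod ?N"
  have jk: "j < ?N" "k < ?N"
    unfolding j_def k_def using len by (intro mod_less_divisor, linarith)+
  have k_eq: "k = (if i = 0 then ?N - 1 else i - 1)"
    using i len by (auto simp: k_def mod_if)
  have j_eq: "j = (if Suc i = ?N then 0 else Suc i)"
    using i by (auto simp: j_def)
  have "Suc k mod ?N = i"
    using i len by (auto simp: k_eq)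
  then have "{cs ! i, cs ! j} \<in> parent_edges n f" "{cs ! i, cs ! k} \<in> parent_edges n f"
    using edge[OF i] edge[OF jk(2)] by (simp_all add: j_def insert_commute)
  then have "cs ! j = cs ! k"
    using parent max jk by metis
  moreover have "j \<noteq> k"
    using len i by (auto simp: j_eq k_eq)
  ultimately show False
    using dist jk nth_eq_iff_index_eq by blast
qed

text \<open>Induction on the height under \<open>f\<close>: the edge \<open>{j, f j}\<close> is a
  parent edge of \<open>g\<close>, so \<open>g j = f j\<close> or \<open>g (f j) = j\<close>. In the
  second case the induction hypothesis at \<open>f j\<close> gives \<open>f (f j) = j\<close>,
  against strictly decreasing heights.\<close>

lemma inj_on_parent_edges:
  assumes n: "0 < n"
  shows "inj_on (parent_edges n) (parent_maps n E)"
proof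
  fix f g assume f: "f \<in> parent_maps n E" and g: "g \<in> parent_maps n E"
    and eq: "parent_edges n f = parent_edges n g"
  have "g j = f j" if "0 < j" "j < n" for j
    using that
  proof (induction "height f j" arbitrary: j rule: less_induct)
    case less
    have "{j, f j} \<in> parent_edges n g"
      using less.prems unfolding eq[symmetric] mem_parent_edges_iff by auto
    then consider "g j = f j" | "0 < f j" "f j < n" "g (f j) = j"
      by (auto simp: mem_parent_edges_iff)
    then show ?case
    proof cases
      case 2
      have h: "height f j = Suc (height f (f j))" "height f (f j) = Suc (height f (f (f j)))"
        using parent_mapsD(4)[OF f] less.prems 2 by auto
      then have "f (f j) = j"
        using less.hyps[of "f j"] 2 by auto
      with h show ?thesis by simp
    qed simp
  qed
  then have "f j = g j" if "j < n" for j
    using that parent_mapsD(1)[OF f n] parent_mapsD(1)[OF g n] by (cases "j = 0") auto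
  with f g show "f = g"
    by (auto simp: parent_maps_def intro: PiE_ext)
qed

section \<open>From spanning trees to parent maps\<close>

text \<open>Prepending a vertex that already occurs closes a detour; cutting back to the suffix that
  starts there keeps the path simple.\<close>

lemma rtrancl_distinct_path:
  assumes "(x, y) \<in> R\<^sup>*"
  shows "\<exists>xs. xs \<noteq> [] \<and> hd xs = x \<and> last xs = y \<and> distinct xs \<and> successively (\<lambda>a b. (a, b) \<in> R) xs"
  using assms
proof (induction rule: converse_rtrancl_induct)
  case base
  show ?case by (intro exI[of _ "[y]"]) auto
next
  case (step x z)
  then obtain xs where xs: "xs \<noteq> []" "hd xs = z" "last xs = y" "distinct xs"
    "successively (\<lambda>a b. (a, b) \<in> R) xs" by blast
  show ?case
  proof (cases "x \<in> set xs")
    case False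
    with xs step.hyps show ?thesis
      by (intro exI[of _ "x # xs"]) (auto simp: successively_Cons)
  next
    case True
    then obtain ys zs where "xs = ys @ x # zs" by (meson split_list)
    with xs show ?thesis
      by (intro exI[of _ "x # zs"]) (auto simp: successively_append_iff)
  qed
qed

text \<open>A simple path in \<open>S\<close> from \<open>a\<close> to \<open>b\<close>, closed up
  by an edge \<open>{a, b}\<close> missing from \<open>S\<close>, would be a cycle in
  \<open>T\<close>.\<close>

lemma acyclic_superset_of_connected:
  assumes conn: "connected_graph (V, S)" and "S \<subseteq> T" and acyc: "\<And>cs. \<not> is_cycle (V, T) cs"
    and ab: "{a, b} \<in> T" "a \<noteq> b" "a \<in> V" "b \<in> V"
  shows "{a, b} \<in> S"
proof (rule ccontr)
  assume notin: "{a, b} \<notin> S"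
  have "(a, b) \<in> {(a, b). {a, b} \<in> S}\<^sup>*"
    using conn ab by (auto simp: connected_graph_def)
  from rtrancl_distinct_path[OF this, unfolded mem_Collect_eq case_prod_conv]
  obtain xs where xs: "xs \<noteq> []" "hd xs = a" "last xs = b" "distinct xs"
    "successively (\<lambda>a b. {a, b} \<in> S) xs"
    by blast
  \<comment> \<open>Length one would force \<open>a = b\<close>, and length two would put
    \<open>{a, b}\<close> into \<open>S\<close>.\<close>
  have "length xs \<noteq> Suc 0"
    using xs ab by (auto simp: length_Suc_conv)
  moreover have "length xs \<noteq> 2"
    using xs notin by (auto simp: numeral_2_eq_2 length_Suc_conv)
  ultimately have "3 \<le> length xs"
    using xs(1) by (cases "length xs") auto
  moreover have "{xs ! i, xs ! (Suc i mod length xs)} \<in> T" if "i < length xs" for i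
  proof (cases "Suc i < length xs")
    case True
    then show ?thesis
      using xs(5) \<open>S \<subseteq> T\<close> by (auto simp: successively_conv_nth)
  next
    case False
    with that have "i = length xs - 1" "Suc i = length xs" by auto
    then show ?thesis
      using xs ab by (simp add: hd_conv_nth last_conv_nth insert_commute)
  qed
  ultimately have "is_cycle (V, T) xs"
    using xs by (auto simp: is_cycle_def)
  with acyc show False by blast
qed

text \<open>Conversely, a spanning tree arises from sending each vertex to a neighbour that is closer
  to the root.\<close>

lemma spanning_tree_parent_edges:
  assumes E: "E \<subseteq> edges (complete_graph n)" and n: "0 < n"
    and T: "T \<in> spanning_trees ({..<n}, E)"
  shows "T \<in> parent_edges n ` parent_maps n E"
proof -
  let ?R = "{(a, b). {a, b} \<in> T}"
  have TE: "T \<subseteq> E" and conn: "\<And>x. x < n \<Longrightarrow> (x, 0) \<in> ?R\<^sup>*" and acyc: "\<And>cs. \<not> is_cycle ({..<n}, T) cs"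
    using T n by (auto simp: spanning_trees_def is_tree_def connected_graph_def)
  have TK: "a < n \<and> b < n \<and> a \<noteq> b" if "{a, b} \<in> T" for a b
    using that TE E by (fastforce simp: complete_graph_def doubleton_eq_iff)
  define d where "d x = (LEAST k. (x, 0) \<in> ?R ^^ k)" for x :: nat
  \<comment> \<open>The value \<open>undefined\<close> outside the vertex range is what membership
    in \<open>Pi\<^sub>E\<close> demands.\<close>
  define f where "f i = (if i < n then if i = 0 then 0 else SOME k. {i, k} \<in> T \<and> d k < d i else undefined)" for i
  have f: "{i, f i} \<in> T \<and> d (f i) < d i" if i: "0 < i" "i < n" for i
  proof -
    \<comment> \<open>The first step of a shortest walk to the root leads to a neighbour with
      smaller \<open>d\<close>.\<close>
    obtain k0 where "(i, 0) \<in> ?R ^^ k0"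
      using conn[OF i(2)] by (meson rtrancl_imp_relpow)
    then have di: "(i, 0) \<in> ?R ^^ d i"
      unfolding d_def by (rule LeastI)
    with i obtain m where m: "d i = Suc m"
      by (cases "d i") auto
    with di obtain k where "(i, k) \<in> ?R" "(k, 0) \<in> ?R ^^ m"
      using relpow_Suc_D2 by metis
    moreover from this have "d k \<le> m"
      unfolding d_def by (intro Least_le)
    ultimately have "{i, k} \<in> T \<and> d k < d i"
      using m by auto
    then have "{i, SOME k. {i, k} \<in> T \<and> d k < d i} \<in> T \<and> d (SOME k. {i, k} \<in> T \<and> d k < d i) < d i"
      by (rule someI)
    then show ?thesis using i by (simp add: f_def)
  qed
  have f_lt: "f i < n" if "0 < i" "i < n" for i
    using f[OF that] TK by blast
  have "\<exists>k. (f ^^ k) i = 0" if "i < n" for i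
    using that
  proof (induction "d i" arbitrary: i rule: less_induct)
    case less
    show ?case
    proof (cases "i = 0")
      case True
      then show ?thesis by (intro exI[of _ 0]) simp
    next
      case False
      then obtain k where "(f ^^ k) (f i) = 0"
        using less f f_lt by (metis bot_nat_0.not_eq_extremum)
      then show ?thesis
        by (intro exI[of _ "Suc k"]) (simp add: funpow_swap1)
    qed
  qed
  moreover have "f \<in> Pi\<^sub>E {..<n} (parents n E)"
    using f f_lt TE by (auto simp: parents_def PiE_iff extensional_def f_def[of 0] f_def[of "_ :: nat"])
  ultimately have f_in: "f \<in> parent_maps n E"
    by (simp add: parent_maps_def)
  have sub: "parent_edges n f \<subseteq> T"
    using f by (auto simp: parent_edges_def)
  \<comment> \<open>The parent edges already connect all vertices, so a further edge of
    \<open>T\<close> would close a cycle in \<open>T\<close>.\<close>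
  have "e \<in> parent_edges n f" if e: "e \<in> T" for e
  proof -
    obtain a b where "e = {a, b}"
      using subsetD[OF E subsetD[OF TE e]] by (auto simp: complete_graph_def)
    then show ?thesis
      using acyclic_superset_of_connected[OF connected_parent_edges[OF f_in n] sub acyc, of a b] e TK
      by auto
  qed
  with sub f_in show ?thesis by blast
qed

lemma spanning_trees_eq_parent_edges:
  assumes "E \<subseteq> edges (complete_graph n)" and n: "0 < n"
  shows "spanning_trees ({..<n}, E) = parent_edges n ` parent_maps n E"
proof
  show "parent_edges n ` parent_maps n E \<subseteq> spanning_trees ({..<n}, E)"
  proof
    fix T assume "T \<in> parent_edges n ` parent_maps n E"
    then obtain f where f: "f \<in> parent_maps n E" and T: "T = parent_edges n f" by blast
    show "T \<in> spanning_trees ({..<n}, E)"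
      using connected_parent_edges[OF f n] parent_edges_acyclic[OF f n] parent_mapsD(3)[OF f]
      by (auto simp: T spanning_trees_def is_tree_def parent_edges_def)
  qed
qed (use spanning_tree_parent_edges[OF assms] in blast)

lemma tau_eq_card_parent_maps:
  assumes "E \<subseteq> edges (complete_graph n)" and "0 < n"
  shows "tau ({..<n}, E) = card (parent_maps n E)"
  unfolding tau_def spanning_trees_eq_parent_edges[OF assms]
  by (rule card_image) (rule inj_on_parent_edges[OF assms(2)])

section \<open>Determinants of parent maps\<close>

text \<open>This is \<open>I - N\<^sub>f\<close>, where \<open>N\<^sub>f\<close> is the adjacency
  matrix of \<open>f\<close> with the column of the root set to zero; if \<open>f 0 = 0\<close>, row
  \<open>0\<close> is that of the identity.\<close>

definition parent_mat :: "nat \<Rightarrow> (nat \<Rightarrow> nat) \<Rightarrow> real mat" where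
  "parent_mat n f = mat n n (\<lambda>(i, j). of_bool (i = j) - of_bool (f i = j \<and> j \<noteq> 0))"

text \<open>A permutation with nonzero Leibniz term sends each \<open>i\<close> to itself or to
  \<open>f i\<close>, so it never raises the height. As it preserves the total height, it is the
  identity; the diagonal entries are \<open>1\<close> because only the root is fixed by
  \<open>f\<close>.\<close>

lemma det_parent_mat_rooted:
  assumes f0: "f 0 = 0" and root: "\<And>i. i < n \<Longrightarrow> \<exists>k. (f ^^ k) i = 0"
  shows "det (parent_mat n f) = 1"
proof -
  let ?A = "parent_mat n f"
  have A: "?A \<in> carrier_mat n n" by (simp add: parent_mat_def)
  have h: "height f i = Suc (height f (f i))" if "i < n" "i \<noteq> 0" for i
    using root[OF that(1)] height_Suc that(2) by blast
  have off: "(\<Prod>i = 0..<n. ?A $$ (i, p i)) = 0" if p: "p permutes {0..<n}" and "p \<noteq> id" for p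
  proof (rule ccontr)
    assume nz: "(\<Prod>i = 0..<n. ?A $$ (i, p i)) \<noteq> 0"
    have pn: "p i < n" if "i < n" for i
      using p that permutes_in_image by fastforce
    have step: "p i = i \<or> height f (p i) < height f i" if i: "i < n" for i
    proof -
      have "?A $$ (i, p i) \<noteq> 0" using nz i by auto
      then show ?thesis
        using i pn[OF i] h[of i] f0 by (cases "i = 0") (auto simp: parent_mat_def of_bool_def split: if_splits)
    qed
    from that obtain i where i: "p i \<noteq> i" by (auto simp: fun_eq_iff)
    then have "i < n" using p by (auto simp: permutes_def)
    have "(\<Sum>i = 0..<n. height f (p i)) < (\<Sum>i = 0..<n. height f i)"
    proof (rule sum_strict_mono_ex1)
      show "\<forall>i\<in>{0..<n}. height f (p i) \<le> height f i"
        using step by (metis atLeastLessThan_iff less_imp_le order_refl)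
      show "\<exists>i\<in>{0..<n}. height f (p i) < height f i"
        using step[OF \<open>i < n\<close>] i \<open>i < n\<close> by auto
    qed simp
    moreover have "(\<Sum>i = 0..<n. height f (p i)) = (\<Sum>i = 0..<n. height f i)"
      using sum.permute[OF p, of "height f"] by (simp add: o_def)
    ultimately show False by simp
  qed
  have "det ?A = (\<Sum>p\<in>{id}. signof p * (\<Prod>i = 0..<n. ?A $$ (i, p i)))"
    unfolding det_def'[OF A]
    by (rule sum.mono_neutral_right) (auto simp: off permutes_id finite_permutations)
  also have "\<dots> = (\<Prod>i = 0..<n. ?A $$ (i, i))"
    by simp
  also have "\<dots> = 1"
  proof (rule prod.neutral, safe)
    fix i assume "i \<in> {0..<n}"
    then show "?A $$ (i, i) = 1"
      using h[of i] by (cases "i = 0") (auto simp: parent_mat_def)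
  qed
  finally show ?thesis .
qed

text \<open>The indicator of the vertices whose iterates avoid the root lies in the kernel.\<close>

lemma det_parent_mat_not_rooted:
  assumes f0: "f 0 = 0" and fn: "\<And>i. i < n \<Longrightarrow> f i < n"
    and i: "i < n" "\<And>k. (f ^^ k) i \<noteq> 0"
  shows "det (parent_mat n f) = 0"
proof -
  let ?A = "parent_mat n f"
  define x where "x j = (if \<exists>k. (f ^^ k) j = 0 then 0 else 1 :: real)" for j
  have A: "?A \<in> carrier_mat n n" by (simp add: parent_mat_def)
  have xf: "x (f j) = x j" for j
  proof -
    have "(\<exists>k. (f ^^ k) (f j) = 0) \<longleftrightarrow> (\<exists>k. (f ^^ k) j = 0)"
    proof
      assume "\<exists>k. (f ^^ k) (f j) = 0"
      then show "\<exists>k. (f ^^ k) j = 0" by (metis funpow_swap1 funpow_simps_right(2) comp_apply)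
    next
      assume "\<exists>k. (f ^^ k) j = 0"
      then obtain k where "(f ^^ k) j = 0" by blast
      then have "(f ^^ k) (f j) = 0" using f0 by (metis funpow_swap1)
      then show "\<exists>k. (f ^^ k) (f j) = 0" by blast
    qed
    then show ?thesis by (simp add: x_def)
  qed
  have x0: "x 0 = 0"
    unfolding x_def by (metis funpow_0)
  \<comment> \<open>Row \<open>j\<close> evaluates to \<open>x j - x (f j)\<close>, which vanishes
    by \<open>xf\<close>; the omitted column \<open>0\<close> costs nothing since
    \<open>x 0 = 0\<close>.\<close>
  have "?A *\<^sub>v vec n x = 0\<^sub>v n"
  proof (rule eq_vecI)
    fix j assume "j < dim_vec (0\<^sub>v n :: real vec)"
    then have j: "j < n" by simp
    have "(?A *\<^sub>v vec n x) $ j = (\<Sum>l = 0..<n. (of_bool (j = l) - of_bool (f j = l \<and> l \<noteq> 0)) * x l)"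
      using j by (auto simp: scalar_prod_def parent_mat_def intro!: sum.cong)
    also have "\<dots> = (\<Sum>l = 0..<n. (if l = j then x l else 0) - (if l = f j then x l else 0))"
      using x0 by (intro sum.cong) (auto simp: of_bool_def)
    also have "\<dots> = 0"
      using j fn[OF j] xf[of j] by (simp add: sum_subtractf)
    finally show "(?A *\<^sub>v vec n x) $ j = 0\<^sub>v n $ j"
      using j by simp
  qed (simp add: parent_mat_def)
  moreover have "vec n x \<noteq> 0\<^sub>v n"
  proof
    assume "vec n x = 0\<^sub>v n"
    then have "vec n x $ i = 0\<^sub>v n $ i" by simp
    with i(1) have "x i = 0" by simp
    moreover have "x i = 1" unfolding x_def by (rule if_not_P) (use i(2) in blast)
    ultimately show False by simp
  qed
  ultimately show ?thesis
    unfolding det_0_iff_vec_prod_zero[OF A] by (intro exI[of _ "vec n x"]) auto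
qed

text \<open>Row \<open>i\<close> is the sum of the rows that \<open>parent_mat\<close> has for the
  possible parents of \<open>i\<close>; off the root this puts the degree of \<open>i\<close> on the
  diagonal.\<close>

definition grounded_laplacian :: "nat \<Rightarrow> nat set set \<Rightarrow> real mat" where
  "grounded_laplacian n E = mat n n (\<lambda>(i, j). \<Sum>k\<in>parents n E i. of_bool (i = j) - of_bool (k = j \<and> j \<noteq> 0))"

text \<open>Each row is a sum over the possible parents, so by multilinearity the determinant is the sum
  of \<open>det (parent_mat n f)\<close> over all choices \<open>f\<close> of parents.\<close>

lemma det_grounded_laplacian:
  assumes n: "0 < n"
  shows "det (grounded_laplacian n E) = card (parent_maps n E)"
proof -
  let ?P = "Pi\<^sub>E {0..<n} (parents n E)"
  have fin: "finite (parents n E i)" for i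
    by (simp add: parents_def)
  have finP: "finite ?P"
    using fin by (intro finite_PiE) auto
  have K: "grounded_laplacian n E \<in> carrier_mat n n" by (simp add: grounded_laplacian_def)
  have M: "parent_mat n f \<in> carrier_mat n n" for f by (simp add: parent_mat_def)
  have pn: "p i < n" if "p permutes {0..<n}" "i < n" for p :: "nat \<Rightarrow> nat" and i
    using that permutes_in_image by fastforce
  have "det (grounded_laplacian n E) = (\<Sum>p | p permutes {0..<n}. signof p *
      (\<Prod>i = 0..<n. \<Sum>k\<in>parents n E i. of_bool (i = p i) - of_bool (k = p i \<and> p i \<noteq> 0)))"
    unfolding det_def'[OF K]
    by (intro sum.cong refl arg_cong2[where f = "(*)"] prod.cong) (auto simp: grounded_laplacian_def pn)
  \<comment> \<open>Distributing the product over the inner sums chooses one parent per row.\<close>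
  also have "\<dots> = (\<Sum>p | p permutes {0..<n}. \<Sum>f\<in>?P. signof p *
      (\<Prod>i = 0..<n. of_bool (i = p i) - of_bool (f i = p i \<and> p i \<noteq> 0)))"
    by (subst prod_sum_PiE) (auto simp: fin sum_distrib_left)
  also have "\<dots> = (\<Sum>f\<in>?P. \<Sum>p | p permutes {0..<n}. signof p *
      (\<Prod>i = 0..<n. of_bool (i = p i) - of_bool (f i = p i \<and> p i \<noteq> 0)))"
    by (rule sum.swap)
  also have "\<dots> = (\<Sum>f\<in>?P. det (parent_mat n f))"
    unfolding det_def'[OF M]
    by (intro sum.cong refl arg_cong2[where f = "(*)"] prod.cong) (auto simp: parent_mat_def pn)
  also have "\<dots> = (\<Sum>f\<in>?P. of_bool (\<forall>i<n. \<exists>k. (f ^^ k) i = 0))"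
  proof (rule sum.cong[OF refl])
    fix f assume "f \<in> ?P"
    then have f: "f i \<in> parents n E i" if "i < n" for i
      using that by auto
    have "f 0 = 0" using f[of 0] n by (simp add: parents_def)
    moreover have "f i < n" if "i < n" for i
      using f[OF that] n by (auto simp: parents_def split: if_splits)
    ultimately show "det (parent_mat n f) = of_bool (\<forall>i<n. \<exists>k. (f ^^ k) i = 0)"
      using det_parent_mat_rooted[of f n] det_parent_mat_not_rooted[of f n] by fastforce
  qed
  also have "\<dots> = card (parent_maps n E)"
    using finP by (simp add: sum.If_cases of_bool_def parent_maps_def atLeast0LessThan Int_def)
  finally show ?thesis .
qed

section \<open>The matrix-tree theorem\<close>

text \<open>The row sums determine the diagonal of \<open>A\<close>: the off-diagonal part of row
  \<open>i\<close> sums to \<open>n - 1\<close> minus the degree of \<open>i\<close>, which leaves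
  the degree plus \<open>1\<close>.\<close>

lemma grounded_laplacian_entry:
  assumes E: "E \<subseteq> edges (complete_graph n)"
    and off: "\<And>i j. i < n \<Longrightarrow> j < n \<Longrightarrow> i \<noteq> j \<Longrightarrow> A $$ (i, j) = 1 - of_bool ({i, j} \<in> E)"
    and rows: "\<And>i. i < n \<Longrightarrow> (\<Sum>j<n. A $$ (i, j)) = real n"
    and i: "i < n" and j: "j < n"
  shows "grounded_laplacian n E $$ (i, j)
    = (if i = 0 \<or> j = 0 then of_bool (i = j) else A $$ (i, j) - 1)"
proof -
  have loop: "{k, k} \<notin> E" for k
    using E by (auto simp: complete_graph_def doubleton_eq_iff)
  have fin: "finite (parents n E i)"
    by (simp add: parents_def)
  have K: "grounded_laplacian n E $$ (i, j)
    = real (card (parents n E i)) * of_bool (i = j) - of_bool (j \<in> parents n E i \<and> j \<noteq> 0)"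
  proof -
    have "(\<Sum>k\<in>parents n E i. of_bool (k = j \<and> j \<noteq> 0) :: real)
        = (\<Sum>k\<in>parents n E i. if k = j then of_bool (j \<noteq> 0) else 0 :: real)"
      by (intro sum.cong) auto
    also have "\<dots> = of_bool (j \<in> parents n E i \<and> j \<noteq> 0)"
      using fin by (simp add: sum.delta')
    finally show ?thesis
      using i j by (simp add: grounded_laplacian_def sum_subtractf)
  qed
  show ?thesis
  proof (cases "i = 0 \<or> j = 0")
    case True
    then show ?thesis
      unfolding K using loop[of 0] by (auto simp: parents_def)
  next
    case False
    show ?thesis
    proof (cases "i = j")
      case True
      have "(\<Sum>k<n. A $$ (i, k)) = A $$ (i, i) + (\<Sum>k\<in>{..<n} - {i}. A $$ (i, k))"
        using i by (simp add: sum.remove)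
      also have "(\<Sum>k\<in>{..<n} - {i}. A $$ (i, k)) = (\<Sum>k\<in>{..<n} - {i}. 1 - of_bool ({i, k} \<in> E))"
        using i by (intro sum.cong) (auto simp: off)
      also have "\<dots> = (real n - 1) - (\<Sum>k\<in>{..<n} - {i}. of_bool ({i, k} \<in> E))"
        using i by (simp add: sum_subtractf)
      also have "(\<Sum>k\<in>{..<n} - {i}. of_bool ({i, k} \<in> E)) = real (card (parents n E i))"
      proof -
        have "({..<n} - {i}) \<inter> {k. {i, k} \<in> E} = parents n E i"
          using False loop[of i] by (auto simp: parents_def)
        then show ?thesis by (simp add: sum_of_bool_eq)
      qed
      finally show ?thesis
        unfolding K using False True loop[of i] rows[OF i] by (auto simp: parents_def)
    next
      case False
      with \<open>\<not> (i = 0 \<or> j = 0)\<close> show ?thesis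
        unfolding K using off[OF i j] j by (auto simp: parents_def)
    qed
  qed
qed

lemma sum_lessThan_split_0:
  fixes f :: "nat \<Rightarrow> 'a :: comm_monoid_add"
  assumes "0 < n"
  shows "(\<Sum>k = 0..<n. f k) = f 0 + (\<Sum>k = 1..<n. f k)"
  using assms by (simp add: sum.atLeast_Suc_lessThan)

text \<open>It maps \<open>x\<close> to the sum of its entries followed by the differences
  \<open>x i - x 0\<close>. The form of \<open>J\<close> is the square of that sum, and the form of
  \<open>L\<close> depends on the differences only, since \<open>L\<close> annihilates
  constants.\<close>

definition root_basis_mat :: "nat \<Rightarrow> real mat" where
  "root_basis_mat n = mat n n (\<lambda>(i, j). if i = 0 then 1 else of_bool (i = j) - of_bool (j = 0))"

text \<open>Multiplying by the unitriangular \<open>P\<close> adds all columns to column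
  \<open>0\<close>; every row but the first sums to \<open>0\<close>, so the product is upper
  triangular with diagonal \<open>n, 1, ..., 1\<close>.\<close>

lemma det_root_basis_mat:
  assumes n: "0 < n"
  shows "det (root_basis_mat n) = real n"
proof -
  let ?S = "root_basis_mat n"
  define P where "P = (mat n n (\<lambda>(i, j). of_bool (i = j \<or> j = 0)) :: real mat)"
  have S: "?S \<in> carrier_mat n n" and P: "P \<in> carrier_mat n n"
    by (simp_all add: root_basis_mat_def P_def)
  define U where "U = (mat n n (\<lambda>(i, j). if i = 0 then if j = 0 then real n else 1 else of_bool (i = j)) :: real mat)"
  have U: "U \<in> carrier_mat n n" by (simp add: U_def)
  have "?S * P = U"
  proof (rule eq_matI)
    fix i j assume "i < dim_row U" "j < dim_col U"
    then have ij: "i < n" "j < n" by (simp_all add: U_def)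
    have "(?S * P) $$ (i, j) = (\<Sum>k = 0..<n. ?S $$ (i, k) * of_bool (k = j \<or> j = 0))"
      using ij S P by (auto simp: scalar_prod_def P_def intro!: sum.cong)
    also have "\<dots> = U $$ (i, j)"
    proof (cases "j = 0")
      case True
      then have "(\<Sum>k = 0..<n. ?S $$ (i, k) * of_bool (k = j \<or> j = 0))
        = (\<Sum>k = 0..<n. if i = 0 then 1 else (if k = i then 1 else 0) - (if k = 0 then 1 else 0))"
        using ij by (intro sum.cong) (auto simp: root_basis_mat_def)
      with True ij show ?thesis
        by (cases "i = 0") (auto simp: U_def sum_subtractf)
    next
      case False
      then have "(\<Sum>k = 0..<n. ?S $$ (i, k) * of_bool (k = j \<or> j = 0))
        = (\<Sum>k = 0..<n. if k = j then ?S $$ (i, k) else 0)"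
        by (intro sum.cong) auto
      with False ij show ?thesis
        by (auto simp: root_basis_mat_def U_def)
    qed
    finally show "(?S * P) $$ (i, j) = U $$ (i, j)" .
  qed (use S P U in auto)
  moreover have "det P = 1"
  proof -
    have "det P = prod_list (diag_mat P)"
      by (rule det_lower_triangular[OF _ P]) (auto simp: P_def)
    also have "\<dots> = 1"
      by (rule prod_list_neutral) (auto simp: diag_mat_def P_def)
    finally show ?thesis .
  qed
  moreover have "det U = real n"
  proof -
    have "det U = prod_list (diag_mat U)"
      by (rule det_upper_triangular[OF _ U]) (auto simp: U_def)
    also have "\<dots> = (\<Prod>i = 0..<n. U $$ (i, i))"
      using U by (simp add: prod_list_diag_prod)
    also have "\<dots> = (\<Prod>i = 0..<n. if i = 0 then real n else 1)"
      by (intro prod.cong) (auto simp: U_def)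
    also have "\<dots> = real n"
      using n by simp
    finally show ?thesis .
  qed
  ultimately show ?thesis
    using det_mult[OF S P] by simp
qed

text \<open>The hypotheses say that \<open>A = L + J\<close> for the Laplacian \<open>L\<close> of the graph and the all-ones
  matrix \<open>J\<close>. It equals \<open>S\<^sup>T K S\<close> with \<open>S\<close> the \<open>root_basis_mat\<close> and \<open>K\<close> the grounded
  Laplacian.\<close>

lemma matrix_tree:
  assumes n: "0 < n" and E: "E \<subseteq> edges (complete_graph n)" and A: "A \<in> carrier_mat n n"
    and off: "\<And>i j. i < n \<Longrightarrow> j < n \<Longrightarrow> i \<noteq> j \<Longrightarrow> A $$ (i, j) = 1 - of_bool ({i, j} \<in> E)"
    and rows: "\<And>i. i < n \<Longrightarrow> (\<Sum>j<n. A $$ (i, j)) = real n"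
  shows "det A = (real n)\<^sup>2 * tau ({..<n}, E)"
proof -
  let ?S = "root_basis_mat n" and ?K = "grounded_laplacian n E"
  have S: "?S \<in> carrier_mat n n" and K: "?K \<in> carrier_mat n n"
    by (simp_all add: root_basis_mat_def grounded_laplacian_def)
  have Kij: "?K $$ (i, j) = (if i = 0 \<or> j = 0 then of_bool (i = j) else A $$ (i, j) - 1)"
    if "i < n" "j < n" for i j
    by (rule grounded_laplacian_entry[OF E off rows that])
  have Sij: "?S $$ (k, i) = (if k = 0 then 1 else of_bool (k = i) - of_bool (i = 0))"
    if "k < n" "i < n" for k i
    using that by (simp add: root_basis_mat_def)
  have symA: "A $$ (i, j) = A $$ (j, i)" if "i < n" "j < n" for i j
    using that off by (cases "i = j") (auto simp: insert_commute)
  \<comment> \<open>The rows of \<open>A - J\<close> sum to zero, so the non-root columns recover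
    the entry in the root column.\<close>
  have row_sum: "(\<Sum>l = 1..<n. A $$ (i, l) - 1) = 1 - A $$ (i, 0)" if "i < n" for i
    using rows[OF that] n sum_lessThan_split_0[OF n, of "\<lambda>l. A $$ (i, l)"]
    by (simp add: sum_subtractf of_nat_diff atLeast0LessThan)
  have KS: "(?K * ?S) $$ (k, j) = (if k = 0 then 1 else A $$ (k, j) - 1)" if k: "k < n" and j: "j < n" for k j
  proof -
    have "(?K * ?S) $$ (k, j) = (\<Sum>l = 0..<n. ?K $$ (k, l) * ?S $$ (l, j))"
      using k j K S by (auto simp: scalar_prod_def intro!: sum.cong)
    also have "\<dots> = ?K $$ (k, 0) + (\<Sum>l = 1..<n. ?K $$ (k, l) * (of_bool (l = j) - of_bool (j = 0)))"
      using n k j by (simp add: sum_lessThan_split_0 root_basis_mat_def)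
    also have "\<dots> = (if k = 0 then 1 else A $$ (k, j) - 1)"
    proof (cases "k = 0")
      case True
      then have "(\<Sum>l = 1..<n. ?K $$ (k, l) * (of_bool (l = j) - of_bool (j = 0))) = 0"
        using k by (intro sum.neutral) (auto simp: Kij)
      with True k n show ?thesis by (simp add: Kij)
    next
      case False
      have "(\<Sum>l = 1..<n. ?K $$ (k, l) * (of_bool (l = j) - of_bool (j = 0)))
          = (\<Sum>l = 1..<n. (if l = j then A $$ (k, l) - 1 else 0) - of_bool (j = 0) * (A $$ (k, l) - 1))"
        using k False by (intro sum.cong) (auto simp: Kij)
      also have "\<dots> = (if 1 \<le> j then A $$ (k, j) - 1 else 0) - of_bool (j = 0) * (1 - A $$ (k, 0))"
        using j row_sum[OF k] by (simp add: sum_subtractf flip: sum_distrib_left)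
      finally show ?thesis
        using False k n by (cases "j = 0") (auto simp: Kij)
    qed
    finally show ?thesis .
  qed
  have "transpose_mat ?S * (?K * ?S) = A"
  proof (rule eq_matI)
    fix i j assume "i < dim_row A" "j < dim_col A"
    then have i: "i < n" and j: "j < n" using A by auto
    have "(transpose_mat ?S * (?K * ?S)) $$ (i, j) = (\<Sum>k = 0..<n. ?S $$ (k, i) * (?K * ?S) $$ (k, j))"
      using i j K S by (auto simp: scalar_prod_def intro!: sum.cong)
    also have "\<dots> = 1 + (\<Sum>k = 1..<n. (of_bool (k = i) - of_bool (i = 0)) * (A $$ (k, j) - 1))"
      using n i j by (simp add: sum_lessThan_split_0 KS Sij del: index_mult_mat(1))
    \<comment> \<open>Symmetry turns column \<open>j\<close> into row \<open>j\<close>, where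
      \<open>row_sum\<close> applies.\<close>
    also have "\<dots> = 1 + (\<Sum>k = 1..<n. (if k = i then A $$ (j, k) - 1 else 0) - of_bool (i = 0) * (A $$ (j, k) - 1))"
      using j by (intro arg_cong2[where f = "(+)"] sum.cong refl) (auto simp: symA[of j])
    also have "\<dots> = 1 + (if 1 \<le> i then A $$ (j, i) - 1 else 0) - of_bool (i = 0) * (1 - A $$ (j, 0))"
      using i row_sum[OF j] by (simp add: sum_subtractf flip: sum_distrib_left)
    also have "\<dots> = A $$ (i, j)"
      using symA[OF i j] by (cases "i = 0") auto
    finally show "(transpose_mat ?S * (?K * ?S)) $$ (i, j) = A $$ (i, j)" .
  qed (use A S K in auto)
  then have "det A = det (transpose_mat ?S) * (det ?K * det ?S)"
    using S K by (metis det_mult mult_carrier_mat transpose_carrier_mat)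
  then show ?thesis
    using det_transpose[OF S]
    by (simp add: det_root_basis_mat[OF n] det_grounded_laplacian[OF n] tau_eq_card_parent_maps[OF E n]
        power2_eq_square mult_ac)
qed

section \<open>The edge-defect matrix\<close>

lemma incidence_mat_carrier: "incidence_mat n es \<in> carrier_mat n (length es)"
  by (rule carrier_matI) (simp_all add: incidence_mat_def)

lemma incidence_mat_entry:
  assumes "i < n" "e < length es" "fst (es ! e) < n" "snd (es ! e) < n"
  shows "incidence_mat n es $$ (i, e) = of_bool (i = fst (es ! e)) - of_bool (i = snd (es ! e))"
  using assms by (cases "es ! e") (simp add: incidence_mat_def mat_of_cols_index)

text \<open>The product of the incidence matrix and its transpose is the Laplacian of
  \<open>F\<close>, and the Laplacian of the complete graph is \<open>n I - J\<close>. Hence the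
  matrix here is \<open>L + J\<close> for the remaining graph, as \<open>matrix_tree\<close>
  requires.\<close>

lemma det_edge_defect_complement:
  assumes n: "0 < n" and F: "F \<subseteq> edges (complete_graph n)" and es: "orients es F"
  shows "det (real n \<cdot>\<^sub>m 1\<^sub>m n - incidence_mat n es * transpose_mat (incidence_mat n es))
    = (real n)\<^sup>2 * tau (delete_edges (complete_graph n) F)"
proof -
  let ?B = "incidence_mat n es"
  let ?A = "real n \<cdot>\<^sub>m 1\<^sub>m n - ?B * transpose_mat ?B"
  let ?p = "length es"
  have B: "?B \<in> carrier_mat n ?p" by (rule incidence_mat_carrier)
  define edge where "edge e = {fst (es ! e), snd (es ! e)}" for e
  have edge_eq: "edge e = (\<lambda>(u, v). {u, v}) (es ! e)" for e
    by (simp add: edge_def split_beta)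
  have F_eq: "F = edge ` {..<?p}"
  proof -
    have "set es = (!) es ` {..<?p}"
      by (auto simp: set_conv_nth)
    then have "F = (\<lambda>(u, v). {u, v}) ` (!) es ` {..<?p}"
      using es by (simp add: orients_def)
    then show ?thesis by (simp add: image_image edge_eq)
  qed
  \<comment> \<open>No edge is listed in both orientations, so sums over list positions become sums
    over \<open>F\<close>.\<close>
  have inj: "inj_on edge {..<?p}"
    using es by (auto simp: orients_def edge_eq distinct_conv_nth inj_on_def)
  have edge: "fst (es ! e) < n \<and> snd (es ! e) < n \<and> fst (es ! e) \<noteq> snd (es ! e)" if "e < ?p" for e
  proof -
    have "edge e \<in> edges (complete_graph n)" using that F F_eq by blast
    then show ?thesis by (auto simp: complete_graph_def edge_def doubleton_eq_iff)
  qed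
  have entry: "?A $$ (i, j) = real n * of_bool (i = j) - (\<Sum>e<?p. ?B $$ (i, e) * ?B $$ (j, e))"
    if "i < n" "j < n" for i j
    using that B by (auto simp: scalar_prod_def atLeast0LessThan intro!: sum.cong)
  show ?thesis
    unfolding delete_edges_def complete_graph_def[of n] fst_conv
  proof (rule matrix_tree[OF n])
    show "snd ({..<n}, {{x, y} |x y. x < n \<and> y < n \<and> x \<noteq> y}) - F \<subseteq> edges (complete_graph n)"
      by (auto simp: complete_graph_def)
    show "?A \<in> carrier_mat n n" using B by auto
  next
    fix i j assume ij: "i < n" "j < n" "i \<noteq> j"
    \<comment> \<open>Only a column whose edge is \<open>{i, j}\<close> has both entries nonzero;
      their product is \<open>-1\<close> for either orientation.\<close>
    have "(\<Sum>e<?p. ?B $$ (i, e) * ?B $$ (j, e)) = (\<Sum>e<?p. - of_bool (edge e = {i, j}))"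
      using ij edge by (intro sum.cong) (auto simp: incidence_mat_entry edge_def doubleton_eq_iff of_bool_def)
    also have "\<dots> = - (\<Sum>x\<in>F. of_bool (x = {i, j}))"
      unfolding F_eq sum.reindex[OF inj] by (simp add: sum_negf)
    also have "\<dots> = - of_bool ({i, j} \<in> F)"
      using F_eq by (cases "{i, j} \<in> F") (auto simp: sum_of_bool_eq)
    finally show "?A $$ (i, j) = 1 - of_bool ({i, j} \<in> snd ({..<n}, {{x, y} |x y. x < n \<and> y < n \<and> x \<noteq> y}) - F)"
      using ij entry by auto
  next
    fix i assume i: "i < n"
    have col: "(\<Sum>j<n. ?B $$ (j, e)) = 0" if "e < ?p" for e
      using that edge[OF that] by (simp add: incidence_mat_entry sum_subtractf sum_of_bool_eq)
    have "(\<Sum>j<n. ?A $$ (i, j))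
        = (\<Sum>j<n. if j = i then real n else 0) - (\<Sum>j<n. \<Sum>e<?p. ?B $$ (i, e) * ?B $$ (j, e))"
      unfolding sum_subtractf[symmetric] using i by (intro sum.cong) (auto simp: entry)
    also have "(\<Sum>j<n. \<Sum>e<?p. ?B $$ (i, e) * ?B $$ (j, e)) = (\<Sum>e<?p. ?B $$ (i, e) * (\<Sum>j<n. ?B $$ (j, e)))"
      unfolding sum_distrib_left by (rule sum.swap)
    also have "\<dots> = 0" by (simp add: col)
    finally show "(\<Sum>j<n. ?A $$ (i, j)) = real n" using i by simp
  qed
qed

theorem theorem4p2:
  fixes n p :: nat and F :: "nat set set" and es :: "(nat \<times> nat) list"
    and Q :: "real mat" and \<theta> :: "real list"
  assumes "F \<subseteq> edges (complete_graph n)"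
    and "card F = p" and "p \<ge> 1"
    and "connected_graph (delete_edges (complete_graph n) F)"
    and "orients es F"
    and "Q = edge_defect_mat n es"
    and "mset \<theta> = eigenvalues_mset Q"
  shows "real (tau (delete_edges (complete_graph n) F))
           = real n ^ (n - 2) * (\<Prod>\<alpha><p. 1 - \<theta> ! \<alpha> / real n)
       \<and> real n ^ (n - 2) * (\<Prod>\<alpha><p. 1 - \<theta> ! \<alpha> / real n)
           = real n powi (int n - int p - 2) * det (real n \<cdot>\<^sub>m 1\<^sub>m p - Q)"
proof -
  let ?B = "incidence_mat n es" and ?t = "real (tau (delete_edges (complete_graph n) F))"
  let ?D = "det (real n \<cdot>\<^sub>m 1\<^sub>m p - Q)"
  have "F \<noteq> {}" using assms(2,3) by auto
  \<comment> \<open>An edge needs two vertices; this bound makes the truncated \<open>n - 2\<close>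
    the true difference.\<close>
  then have n: "2 \<le> n"
    using assms(1) by (fastforce simp: complete_graph_def)
  have p: "length es = p"
    using assms(2,5) distinct_card by (fastforce simp: orients_def)
  have B: "?B \<in> carrier_mat n p" using incidence_mat_carrier[of n es] p by simp
  have Q: "Q \<in> carrier_mat p p" "transpose_mat Q = Q"
    using B transpose_mult[of "transpose_mat ?B" p n ?B p] by (auto simp: assms(6) edge_defect_mat_def)
  note \<theta> = real_symmetric_char_poly_eigenvalues[OF Q assms(7)]
  have "real n ^ p * ((real n)\<^sup>2 * ?t) = real n ^ n * ?D"
    using det_smult_one_minus_mult_commute[of ?B n p "transpose_mat ?B" "real n"] B n
      det_edge_defect_complement[OF _ assms(1,5)]
    by (simp add: assms(6) edge_defect_mat_def)
  also have "real n ^ n = (real n)\<^sup>2 * real n ^ (n - 2)"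
    using n by (metis le_add_diff_inverse power_add)
  finally have t: "?t = real n ^ (n - 2) * ?D / real n ^ p"
    using n by (simp add: field_simps)
  \<comment> \<open>The determinant is the characteristic polynomial of \<open>Q\<close> evaluated
    at \<open>n\<close>.\<close>
  have "?D = poly (char_poly Q) (real n)"
    unfolding char_poly_matrix[OF Q(1)] using Q
    by (intro arg_cong[where f = det] eq_matI) (auto simp: char_matrix_def)
  also have "\<dots> = (\<Prod>t\<leftarrow>\<theta>. real n - t)"
    unfolding \<theta>(1) by (simp add: poly_prod_list o_def)
  also have "\<dots> = (\<Prod>\<alpha><p. real n - \<theta> ! \<alpha>)"
    using \<theta>(2) by (simp add: prod.list_conv_set_nth atLeast0LessThan)
  also have "\<dots> / real n ^ p = (\<Prod>\<alpha><p. (real n - \<theta> ! \<alpha>) / real n)"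
    by (simp add: prod_dividef)
  also have "\<dots> = (\<Prod>\<alpha><p. 1 - \<theta> ! \<alpha> / real n)"
    using n by (simp add: diff_divide_distrib)
  finally have prod: "?D / real n ^ p = (\<Prod>\<alpha><p. 1 - \<theta> ! \<alpha> / real n)" .
  \<comment> \<open>The exponent may be negative, so the integer power is split into a quotient of
    natural powers.\<close>
  have "int n - int p - 2 = int (n - 2) - int p"
    using n by simp
  then have powi: "real n powi (int n - int p - 2) = real n ^ (n - 2) / real n ^ p"
    using n power_int_diff[of "real n" "int (n - 2)" "int p"] by (simp only: power_int_of_nat) simp
  show ?thesis
    unfolding t powi prod[symmetric] by (simp only: times_divide_eq_right times_divide_eq_left simp_thms)
qed

end
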